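(* Let $K$ be an algebraically closed field. Suppose that $m\geq 4$, $i\mid m-1$ for some natural number $i$ such that $2\leq i\leq\frac{m-1}{2}$, and that the number $n(i):=\frac{m-1}{i}-1$ satisfies $n(i)\geq 2$ and is a divisor neither of $m-1$ nor of $m-2$. Let $f_i=x^{n(i)}(1+x^{l(i)})$ where $l(i)=\frac{i-1}{i}(m-1)$, and $A_i=K+\sum_{j\geq 1}Kf_i^j+x^mK[x]$. Then: 1. $A_i\in\mathcal{A}(m)$, $\Gamma_{A_i}=\{jn(i)\mid 1\leq j<\frac{m-1}{n(i)}\}$, $\{1,f_i,x^{jn(i)}\mid 2\leq j<\frac{m-1}{n(i)}\}$ is the canonical basis of the algebra $\overline{A_i}=A_i/x^mK[x]$, and $f_i=x^{n(i)}+x^{m-2}$. 2. $\operatorname{Aut}_K(A_i)=\langle t_{\lambda_{l(i)}}\rangle$ if $\operatorname{char}(K)=0$, and $\operatorname{Aut}_K(A_i)=\langle t_{\lambda_{l(i)_p}}\rangle$ if $\operatorname{char}(K)=p>0$.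
   Context: $\mathcal{A}(m)$ is the set of all $K$-subalgebras $A$ of $K[x]$ such that $x^mK[x]\subset A$ and $x^{m-1}\notin A$. For $A\in\mathcal{A}(m)$, $\Gamma_A$ is the set of integers $\gamma$ with $1\leq\gamma\leq m-1$ such that $A$ contains an element of the form $x^\gamma+\sum_{j>\gamma}\lambda_jx^j$. With $\Gamma=\Gamma_A$, the algebra $\overline{A}:=A/x^mK[x]\subseteq K[x]/x^mK[x]=\bigoplus_{i=0}^{m-1}Kx^i$ has a unique $K$-basis $\{1,f_\gamma\mid\gamma\in\Gamma\}$ (the canonical basis) with $f_\gamma=x^\gamma+\sum_{\delta}\lambda_{\gamma\delta}x^\delta$, $\lambda_{\gamma\delta}\in K$, the sum being over $\delta\notin\Gamma$, $\gamma<\delta\leq m-1$. For a prime $p$ and $l\geq 1$, $l_p$ is the $p$-co-prime divisor of $l$: $l=p^kl_p$, $p\nmid l_p$. $t_\lambda$ denotes the automorphism $x\mapsto\lambda x$ of $K[x]$ ($\lambda\in K^\times$), identified with its restriction to $A$ when $t_\lambda(A)=A$; $\lambda_n$ is a primitive $n$-th root of unity in $K$. $\operatorname{Aut}_K(A)$ is the group of $K$-algebra automorphisms of $A$. *)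

theory Defs
  imports
    "HOL-Computational_Algebra.Computational_Algebra"
    "HOL-Algebra.Bij"
    "HOL-Algebra.Generated_Groups"
begin

interpretation poly_vs: vector_space "smult :: 'a::field \<Rightarrow> 'a poly \<Rightarrow> 'a poly"
  by unfold_locales (simp_all add: smult_add_left smult_add_right)

definition subalgebra :: "'a::field poly set \<Rightarrow> bool" where
  "subalgebra A \<longleftrightarrow> poly_vs.subspace A \<and> 1 \<in> A \<and> (\<forall>p\<in>A. \<forall>q\<in>A. p * q \<in> A)"

definition x_power_ideal :: "nat \<Rightarrow> 'a::field poly set" where
  "x_power_ideal m = range (\<lambda>h. monom 1 m * h)"

definition algs :: "nat \<Rightarrow> 'a::field poly set set" where
  "algs m = {A. subalgebra A \<and> x_power_ideal m \<subseteq> A \<and> monom 1 (m - 1) \<notin> A}"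

definition Gam :: "nat \<Rightarrow> 'a::field poly set \<Rightarrow> nat set" where
  "Gam m A = {\<gamma>. 1 \<le> \<gamma> \<and> \<gamma> \<le> m - 1 \<and> (\<exists>a\<in>A. coeff a \<gamma> = 1 \<and> (\<forall>j<\<gamma>. coeff a j = 0))}"

text \<open>
  The quotient of \<open>K[x]\<close> by \<open>x\<^sup>m K[x]\<close> is identified, as a \<open>K\<close>-vector space, with the span of
  \<open>1, x, \<dots>, x\<^bsup>m-1\<^esup>\<close>: the class of \<open>p\<close> is represented by \<open>poly_cutoff m p\<close>.
\<close>

definition quot_alg :: "nat \<Rightarrow> 'a::field poly set \<Rightarrow> 'a poly set" where
  "quot_alg m A = poly_cutoff m ` A"

definition is_basis_of :: "'a::field poly set \<Rightarrow> 'a poly set \<Rightarrow> bool" where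
  "is_basis_of B V \<longleftrightarrow> poly_vs.independent B \<and> poly_vs.span B = V"

text \<open>
  A basis \<open>B\<close> of the quotient consisting of \<open>1\<close> and one \<open>f \<gamma>\<close> for each \<open>\<gamma>\<close> in \<open>Gam m A\<close>, where
  \<open>f \<gamma>\<close> is \<open>x\<^sup>\<gamma>\<close> plus a combination of powers \<open>x\<^sup>\<delta>\<close> with \<open>\<gamma> < \<delta> \<le> m - 1\<close> and \<open>\<delta>\<close> outside
  \<open>Gam m A\<close>.
\<close>

definition is_canonical_basis :: "nat \<Rightarrow> 'a::field poly set \<Rightarrow> 'a poly set \<Rightarrow> bool" where
  "is_canonical_basis m A B \<longleftrightarrow>
     (\<exists>(f :: nat \<Rightarrow> 'a poly) (c :: nat \<Rightarrow> nat \<Rightarrow> 'a).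
        B = insert 1 (f ` Gam m A) \<and>
        (\<forall>\<gamma>\<in>Gam m A.
           f \<gamma> = monom 1 \<gamma> + (\<Sum>\<delta>\<in>{\<gamma><..m - 1} - Gam m A. monom (c \<gamma> \<delta>) \<delta>)) \<and>
        is_basis_of B (quot_alg m A))"

text \<open>The unique \<open>d\<close> with \<open>l = p\<^sup>k d\<close> and \<open>p\<close> not dividing \<open>d\<close> (for prime \<open>p\<close> and \<open>l > 0\<close>).\<close>

definition coprime_part :: "nat \<Rightarrow> nat \<Rightarrow> nat" where
  "coprime_part p l = (THE d. \<exists>k. l = p ^ k * d \<and> \<not> p dvd d)"

lemma coprime_part_eq:
  assumes "prime p" and "l > 0"
  shows "coprime_part p l = l div p ^ multiplicity p l"
proof -
  have ml: "p ^ multiplicity p l * (l div p ^ multiplicity p l) = l"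
    by (simp add: multiplicity_dvd)
  have "\<not> p dvd l div p ^ multiplicity p l"
    using assms multiplicity_decompose[of l p] prime_gt_1_nat[of p] by simp
  moreover have "d = l div p ^ multiplicity p l" if "l = p ^ k * d" "\<not> p dvd d" for d k
  proof -
    have "multiplicity p l = k"
      using that assms
      by (metis multiplicity_eqI dvd_triv_left not_prime_0 power_Suc2 dvd_times_left_cancel_iff
          power_not_zero)
    then show ?thesis using that assms prime_gt_0_nat[of p] by simp
  qed
  ultimately show ?thesis
    unfolding coprime_part_def using ml by (intro the_equality) metis+
qed

definition is_primitive_root :: "nat \<Rightarrow> 'a::field \<Rightarrow> bool" where
  "is_primitive_root n z \<longleftrightarrow> n > 0 \<and> z ^ n = 1 \<and> (\<forall>k. 0 < k \<and> k < n \<longrightarrow> z ^ k \<noteq> 1)"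

text \<open>
  Elements of the automorphism group are extensional (undefined outside \<open>A\<close>), so a map defined
  on all of \<open>K[x]\<close> has to be restricted to \<open>A\<close> before it can be an element.
\<close>

definition alg_auts :: "'a::field poly set \<Rightarrow> ('a poly \<Rightarrow> 'a poly) set" where
  "alg_auts A = {\<phi> \<in> Bij A. \<phi> 1 = 1 \<and>
     (\<forall>p\<in>A. \<forall>q\<in>A. \<phi> (p + q) = \<phi> p + \<phi> q \<and> \<phi> (p * q) = \<phi> p * \<phi> q) \<and>
     (\<forall>c. \<forall>p\<in>A. \<phi> (smult c p) = smult c (\<phi> p))}"

definition Aut_alg :: "'a::field poly set \<Rightarrow> ('a poly \<Rightarrow> 'a poly) monoid" where
  "Aut_alg A = (BijGroup A)\<lparr>carrier := alg_auts A\<rparr>"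

lemma group_Aut_alg:
  assumes A: "subalgebra A"
  shows "group (Aut_alg A)"
proof -
  have cl: "1 \<in> A" "\<And>p q. p \<in> A \<Longrightarrow> q \<in> A \<Longrightarrow> p + q \<in> A"
    "\<And>p q. p \<in> A \<Longrightarrow> q \<in> A \<Longrightarrow> p * q \<in> A" "\<And>c p. p \<in> A \<Longrightarrow> smult c p \<in> A"
    using A by (auto simp: subalgebra_def poly_vs.subspace_def)
  have "subgroup (alg_auts A) (BijGroup A)"
  proof (rule subgroup.intro)
    show "alg_auts A \<subseteq> carrier (BijGroup A)"
      by (auto simp: alg_auts_def BijGroup_def)
  next
    fix \<phi> \<psi> assume h: "\<phi> \<in> alg_auts A" "\<psi> \<in> alg_auts A"
    then have B: "\<phi> \<in> Bij A" "\<psi> \<in> Bij A" by (auto simp: alg_auts_def)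
    have "\<And>p. p \<in> A \<Longrightarrow> \<psi> p \<in> A" using B Bij_imp_funcset by blast
    then have "compose A \<phi> \<psi> \<in> alg_auts A"
      using h cl compose_Bij[OF B] by (simp add: alg_auts_def compose_def)
    then show "\<phi> \<otimes>\<^bsub>BijGroup A\<^esub> \<psi> \<in> alg_auts A"
      using B by (simp add: BijGroup_def)
  next
    show "\<one>\<^bsub>BijGroup A\<^esub> \<in> alg_auts A"
      using cl by (simp add: BijGroup_def alg_auts_def id_Bij)
  next
    fix \<phi> assume h: "\<phi> \<in> alg_auts A"
    then have B: "\<phi> \<in> Bij A" by (auto simp: alg_auts_def)
    then have inj: "inj_on \<phi> A" and im: "\<phi> ` A = A" by (auto simp: Bij_def bij_betw_def)
    let ?i = "inv_into A \<phi>"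
    have mem: "?i p \<in> A" and val: "\<phi> (?i p) = p" if "p \<in> A" for p
      using that im by (auto simp: inv_into_into f_inv_into_f)
    have eq: "?i p = q" if "q \<in> A" "\<phi> q = p" for p q
      using that inj by auto
    have "?i 1 = 1" using h cl by (intro eq) (auto simp: alg_auts_def)
    moreover have "?i (p + q) = ?i p + ?i q" "?i (p * q) = ?i p * ?i q"
      if "p \<in> A" "q \<in> A" for p q
      using h cl mem val that by (auto intro!: eq simp: alg_auts_def)
    moreover have "?i (smult c p) = smult c (?i p)" if "p \<in> A" for c p
      using h cl mem val that by (auto intro!: eq simp: alg_auts_def)
    ultimately have "restrict ?i A \<in> alg_auts A"
      using cl restrict_inv_into_Bij[OF B] by (simp add: alg_auts_def)
    then show "inv\<^bsub>BijGroup A\<^esub> \<phi> \<in> alg_auts A"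
      using inv_BijGroup[OF B] by simp
  qed
  then show ?thesis
    unfolding Aut_alg_def
    by (rule subgroup.subgroup_is_group) (rule group_BijGroup)
qed

definition t_aut :: "'a::field \<Rightarrow> 'a poly \<Rightarrow> 'a poly" where
  "t_aut z p = pcompose p [:0, z:]"

text \<open>
  The parameters below are used for \<open>i\<close> dividing \<open>m - 1\<close> and \<open>2 \<le> i \<le> (m - 1) / 2\<close>; the divisions
  are then exact and the subtractions do not truncate.
\<close>

definition n_of :: "nat \<Rightarrow> nat \<Rightarrow> nat" where
  "n_of m i = (m - 1) div i - 1"

definition l_of :: "nat \<Rightarrow> nat \<Rightarrow> nat" where
  "l_of m i = (i - 1) * (m - 1) div i"

definition f_of :: "nat \<Rightarrow> nat \<Rightarrow> 'a::field poly" where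
  "f_of m i = monom 1 (n_of m i) * (1 + monom 1 (l_of m i))"

definition A_of :: "nat \<Rightarrow> nat \<Rightarrow> 'a::field poly set" where
  "A_of m i = {[:c:] + g + h | c g h.
     g \<in> poly_vs.span {f_of m i ^ j | j. j \<ge> 1} \<and> h \<in> x_power_ideal m}"

end

theory Submission
  imports Defs
begin

text \<open>
  Since \<open>f\<^sup>j \<equiv> x\<^bsup>jn\<^esup>\<close> modulo \<open>x\<^sup>m\<close> for \<open>j \<ge> 2\<close>, membership in \<open>A\<close> is a condition on coefficients:
  those of \<open>x\<^sup>n\<close> and \<open>x\<^bsup>m-2\<^esup>\<close> agree, and below \<open>x\<^sup>m\<close> all other coefficients at non-multiples of \<open>n\<close>
  vanish.  An automorphism of an algebra in \<open>algs m\<close> is the restriction of a substitution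
  \<open>x \<mapsto> w\<close>.  Surjectivity forces \<open>w\<close> to be linear, and its constant term is zero: otherwise \<open>A\<close>
  would contain the coprime ideals generated by \<open>x\<^sup>m\<close> and \<open>w\<^sup>m\<close>, hence everything.  The scaling
  \<open>x \<mapsto> ax\<close> preserves \<open>A\<close> iff \<open>a\<^sup>n = a\<^bsup>m-2\<^esup>\<close>, that is \<open>a\<^sup>l = 1\<close>, and in characteristic \<open>p\<close> the
  \<open>l\<close>-th roots of unity are the roots of unity of the order given by the part of \<open>l\<close> prime to \<open>p\<close>.
\<close>

section \<open>Roots of unity\<close>

lemma is_primitive_root_pow_eq_1_iff:
  assumes "is_primitive_root n z"
  shows "z ^ k = 1 \<longleftrightarrow> n dvd k"
proof -
  have n: "n > 0" "z ^ n = 1" and min: "\<And>k. 0 < k \<Longrightarrow> k < n \<Longrightarrow> z ^ k \<noteq> 1"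
    using assms by (auto simp: is_primitive_root_def)
  have "z ^ k = z ^ (n * (k div n) + k mod n)"
    by simp
  also have "\<dots> = z ^ (k mod n)"
    unfolding power_add power_mult by (simp add: n)
  finally have "z ^ k = z ^ (k mod n)" .
  then show ?thesis
    using min[of "k mod n"] n(1) by (auto simp: dvd_eq_mod_eq_0)
qed

lemma is_primitive_rootI:
  assumes "n > 0" "z ^ n = 1" "\<And>k. z ^ k = 1 \<Longrightarrow> n dvd k"
  shows "is_primitive_root n z"
  unfolding is_primitive_root_def using assms nat_dvd_not_less by blast

text \<open>A root \<open>z\<close> of \<open>1 + x + ... + x ^ (r - 1)\<close> satisfies
  \<open>z ^ r = 1\<close>, and it differs from 1 because the sum at 1 is \<open>r\<close>, which is
  nonzero in the field. As \<open>r\<close> is prime, its order is then exactly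
  \<open>r\<close>.\<close>

lemma ex_prime_primitive_root:
  fixes r :: nat
  assumes "prime r" "of_nat r \<noteq> (0::'a::alg_closed_field)"
  shows "\<exists>z::'a. is_primitive_root r z"
proof -
  have r: "r > 1"
    using assms(1) by (rule prime_gt_1_nat)
  define p :: "'a poly" where "p = (\<Sum>k<r. monom 1 k)"
  have "coeff p (r - 1) = 1"
    using r by (simp add: p_def coeff_sum)
  then have "degree p \<ge> r - 1"
    by (intro le_degree) auto
  then have "degree p > 0"
    using r by simp
  then obtain z where z: "poly p z = 0"
    using alg_closed_imp_poly_has_root by blast
  then have sum: "(\<Sum>k<r. z ^ k) = 0"
    by (simp add: p_def poly_sum poly_monom)
  have "z \<noteq> 1"
    using sum assms(2) by auto
  have "z ^ r = 1"
    using power_diff_1_eq[of z r] sum by simp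
  have "r dvd k" if k: "z ^ k = 1" for k
  proof (rule ccontr)
    assume "\<not> r dvd k"
    then have "coprime k r"
      using assms(1) by (metis coprime_commute prime_imp_coprime)
    then have *: "coprime r k"
      by (simp add: coprime_commute)
    \<comment> \<open>A side condition of \<open>coprime_bezout_strong\<close>, which yields the
      Bezout identity in natural numbers.\<close>
    have "k \<noteq> 1"
      using k \<open>z \<noteq> 1\<close> by auto
    then obtain a b where "r * a = k * b + 1"
      using coprime_bezout_strong[OF *] by blast
    then have "z ^ (r * a) = z ^ (k * b) * z"
      by simp
    then show False
      using \<open>z \<noteq> 1\<close> \<open>z ^ r = 1\<close> k by (simp add: power_mult)
  qed
  then show ?thesis
    using is_primitive_rootI[of r z] r \<open>z ^ r = 1\<close> by auto
qed

text \<open>The order is built up one prime factor \<open>r\<close> at a time. If \<open>r\<close>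
  already divides \<open>n\<close>, an \<open>r\<close>-th root of a primitive \<open>n\<close>-th
  root is taken; otherwise primitive roots of the coprime orders \<open>r\<close> and
  \<open>n\<close> are multiplied.\<close>

lemma ex_primitive_root:
  assumes "of_nat n \<noteq> (0::'a::alg_closed_field)"
  shows "\<exists>z::'a. is_primitive_root n z"
  using assms
proof (induction n rule: prime_divisors_induct)
  case zero
  then show ?case by simp
next
  case (unit n)
  then show ?case
    by (auto intro!: exI[of _ 1] is_primitive_rootI)
next
  case (factor r n)
  have nz: "of_nat r \<noteq> (0::'a)" "of_nat n \<noteq> (0::'a)"
    using factor.prems by auto
  obtain z :: 'a where z: "is_primitive_root n z"
    using factor.IH nz by blast
  note z_iff = is_primitive_root_pow_eq_1_iff[OF z]
  have pos: "r > 0" "n > 0"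
    using nz by (auto intro!: Nat.gr0I)
  show ?case
  proof (cases "r dvd n")
    case True
    obtain w where w: "w ^ r = z"
      using nth_root_exists pos by blast
    have "r * n dvd k" if k: "w ^ k = 1" for k
    proof -
      have "z ^ k = 1"
        unfolding w[symmetric] by (metis k mult.commute power_mult power_one)
      then have "r dvd k"
        using z_iff True dvd_trans by blast
      then obtain k' where k': "k = r * k'" ..
      then have "z ^ k' = 1"
        using k w by (simp add: power_mult)
      then show ?thesis
        using k' z_iff by auto
    qed
    moreover have "w ^ (r * n) = 1"
      by (simp add: power_mult w z_iff)
    ultimately show ?thesis
      using pos is_primitive_rootI[of "r * n" w] by auto
  next
    case False
    then have cop: "coprime r n"
      using factor.hyps prime_imp_coprime by blast
    obtain y :: 'a where y: "is_primitive_root r y"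
      using ex_prime_primitive_root factor.hyps nz by blast
    note y_iff = is_primitive_root_pow_eq_1_iff[OF y]
    have "r * n dvd k" if k: "(z * y) ^ k = 1" for k
    proof -
      \<comment> \<open>Raising to the power \<open>r\<close> removes \<open>y\<close> and isolates
        the condition on \<open>z\<close>.\<close>
      have "z ^ (r * k) * y ^ (r * k) = 1"
        by (metis k mult.commute power_mult power_mult_distrib power_one)
      then have "n dvd r * k"
        using y_iff[of "r * k"] z_iff[of "r * k"] by simp
      then have "n dvd k"
        using cop by (simp add: coprime_commute coprime_dvd_mult_right_iff)
      then have "y ^ k = 1"
        using k z_iff[of k] by (simp add: power_mult_distrib)
      then show ?thesis
        using y_iff \<open>n dvd k\<close> cop by (simp add: divides_mult)
    qed
    moreover have "(z * y) ^ (r * n) = 1"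
      using y_iff[of "r * n"] z_iff[of "r * n"] by (simp add: power_mult_distrib)
    ultimately show ?thesis
      using pos is_primitive_rootI[of "r * n" "z * y"] by auto
  qed
qed

text \<open>The powers of \<open>z\<close> below \<open>n\<close> are \<open>n\<close> distinct
  roots of \<open>x ^ n - 1\<close>, which has at most \<open>n\<close> roots, so they exhaust
  them.\<close>

lemma root_of_unity_eq_power:
  fixes a z :: "'a::field"
  assumes z: "is_primitive_root n z" and a: "a ^ n = 1"
  obtains k where "a = z ^ k"
proof -
  have n: "n > 0" "z ^ n = 1" and min: "\<And>k. 0 < k \<Longrightarrow> k < n \<Longrightarrow> z ^ k \<noteq> 1"
    using z by (auto simp: is_primitive_root_def)
  then have "z \<noteq> 0"
    by (auto simp: zero_power)
  let ?p = "monom 1 n - 1 :: 'a poly"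
  have deg: "degree ?p \<le> n"
    by (intro degree_diff_le) (simp_all add: degree_monom_le)
  have "coeff ?p n \<noteq> 0"
    using n by simp
  then have nz: "?p \<noteq> 0"
    by (metis coeff_0)
  have roots: "{x. poly ?p x = 0} = {x. x ^ n = 1}"
    by (auto simp: poly_monom)
  have inj: "inj_on (\<lambda>k. z ^ k) {..<n}"
  proof (rule linorder_inj_onI)
    fix i j assume "i < j" "i \<in> {..<n}" "j \<in> {..<n}"
    then have "z ^ (j - i) \<noteq> 1"
      by (intro min) auto
    then show "z ^ i \<noteq> z ^ j"
      using \<open>i < j\<close> \<open>z \<noteq> 0\<close> by (simp add: power_diff)
  qed auto
  have "(\<lambda>k. z ^ k) ` {..<n} = {x. x ^ n = 1}"
  proof (rule card_subset_eq)
    show "finite {x::'a. x ^ n = 1}"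
      using poly_roots_finite[OF nz] roots by simp
    show "(\<lambda>k. z ^ k) ` {..<n} \<subseteq> {x. x ^ n = 1}"
      by (auto simp flip: power_mult simp: is_primitive_root_pow_eq_1_iff[OF z])
    then have "card ((\<lambda>k. z ^ k) ` {..<n}) \<le> card {x::'a. x ^ n = 1}"
      using \<open>finite {x::'a. x ^ n = 1}\<close> card_mono by blast
    moreover have "card {x::'a. x ^ n = 1} \<le> n"
      using card_poly_roots_bound[OF nz] deg roots by simp
    ultimately show "card ((\<lambda>k. z ^ k) ` {..<n}) = card {x::'a. x ^ n = 1}"
      using card_image[OF inj] by simp
  qed
  then show ?thesis
    using a that by auto
qed

text \<open>By the Frobenius identity, \<open>a ^ q - 1 = (a - 1) ^ q\<close> for \<open>q\<close> a
  power of the characteristic, and a domain has no nilpotents.\<close>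

lemma power_CHAR_power_eq_1_iff:
  fixes a :: "'a::idom"
  assumes "prime CHAR('a)"
  shows "a ^ (CHAR('a) ^ k) = 1 \<longleftrightarrow> a = 1"
proof -
  have "a ^ (CHAR('a) ^ k) = (a - 1) ^ (CHAR('a) ^ k) + 1"
    using freshmans_dream'[OF assms refl, of "a - 1" 1 k] by simp
  moreover have "CHAR('a) ^ k > 0"
    using assms prime_gt_0_nat by auto
  ultimately show ?thesis
    by auto
qed

section \<open>Automorphisms of algebras containing a power of the maximal ideal\<close>

text \<open>Over an algebraically closed field a nonconstant \<open>u\<close> has a root, which is
  also a root of \<open>v\<close>. Cancelling the common linear factor lowers the degree of
  \<open>u\<close>.\<close>

lemma power_dvd_power_imp_dvd:
  fixes u v :: "'a::alg_closed_field poly"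
  assumes "u ^ m dvd v ^ m" "m > 0"
  shows "u dvd v"
  using assms(1)
proof (induction "degree u" arbitrary: u v)
  case 0
  then show ?case
    using assms(2) by (cases "u = 0") (auto simp: is_unit_iff_degree zero_power intro: unit_imp_dvd)
next
  case (Suc d)
  then obtain a where "poly u a = 0"
    using alg_closed_imp_poly_has_root[of u] by auto
  then obtain u' where u': "u = [:-a, 1:] * u'"
    unfolding poly_eq_0_iff_dvd by (rule dvdE)
  have "poly (v ^ m) a = 0"
    using Suc.prems \<open>poly u a = 0\<close> assms(2)
    by (auto elim!: dvdE simp: zero_power simp del: poly_power) (simp add: zero_power)
  then have "poly v a = 0"
    by simp
  then obtain v' where v': "v = [:-a, 1:] * v'"
    unfolding poly_eq_0_iff_dvd by (rule dvdE)
  have "u' \<noteq> 0"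
    using u' Suc.hyps(2) by auto
  then have "d = degree u'"
    using Suc.hyps(2) unfolding u' by (subst (asm) degree_mult_eq) auto
  moreover have "u' ^ m dvd v' ^ m"
    using Suc.prems unfolding u' v' power_mult_distrib by (subst (asm) dvd_times_left_cancel_iff) auto
  ultimately show ?case
    using Suc.hyps(1) unfolding u' v' by (intro mult_dvd_mono dvd_refl) auto
qed

lemma mem_x_power_ideal_iff: "p \<in> x_power_ideal m \<longleftrightarrow> monom 1 m dvd p"
  by (auto simp: x_power_ideal_def dvd_def)

lemma subalgebraD:
  assumes "subalgebra A"
  shows "0 \<in> A" "1 \<in> A" "\<And>p q. p \<in> A \<Longrightarrow> q \<in> A \<Longrightarrow> p + q \<in> A"
    "\<And>p q. p \<in> A \<Longrightarrow> q \<in> A \<Longrightarrow> p * q \<in> A" "\<And>c p. p \<in> A \<Longrightarrow> smult c p \<in> A"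
  using assms by (auto simp: subalgebra_def poly_vs.subspace_def)

lemma alg_autsD:
  assumes "\<phi> \<in> alg_auts A"
  shows "bij_betw \<phi> A A" "\<phi> \<in> extensional A" "\<phi> 1 = 1"
    "\<And>p q. p \<in> A \<Longrightarrow> q \<in> A \<Longrightarrow> \<phi> (p + q) = \<phi> p + \<phi> q"
    "\<And>p q. p \<in> A \<Longrightarrow> q \<in> A \<Longrightarrow> \<phi> (p * q) = \<phi> p * \<phi> q"
    "\<And>c p. p \<in> A \<Longrightarrow> \<phi> (smult c p) = smult c (\<phi> p)"
  using assms by (auto simp: alg_auts_def Bij_def)

lemma subalgebra_power: "subalgebra A \<Longrightarrow> p \<in> A \<Longrightarrow> p ^ k \<in> A"
  by (induction k) (auto intro: subalgebraD)

lemma pcompose_monom: "pcompose (monom c k) w = smult c (w ^ k)"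
  by (induction k) (simp_all add: monom_0 monom_Suc pcompose_pCons)

lemma pcompose_eq_sum:
  fixes p w :: "'a::comm_semiring_1 poly"
  shows "pcompose p w = (\<Sum>j\<le>degree p. smult (coeff p j) (w ^ j))"
proof -
  have "pcompose p w = pcompose (\<Sum>j\<le>degree p. monom (coeff p j) j) w"
    by (simp add: poly_as_sum_of_monoms)
  then show ?thesis
    by (simp add: pcompose_sum pcompose_monom)
qed

text \<open>
  The images \<open>u\<close> and \<open>v\<close> of \<open>x\<^sup>m\<close> and \<open>x\<^bsup>m+1\<^esup>\<close> satisfy \<open>u\<^bsup>m+1\<^esup> = v\<^sup>m\<close>, so \<open>w = v / u\<close> is a
  polynomial with \<open>u = w\<^sup>m\<close> and \<open>v = w\<^bsup>m+1\<^esup>\<close>.  This replaces the extension of the automorphism to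
  the integral closure \<open>K[x]\<close> of \<open>A\<close>.
\<close>

lemma alg_aut_eq_pcompose:
  fixes A :: "'a::alg_closed_field poly set"
  assumes A: "subalgebra A" and ideal: "x_power_ideal m \<subseteq> A" and m: "m > 0"
    and \<phi>: "\<phi> \<in> alg_auts A"
  obtains w where "\<And>p. p \<in> A \<Longrightarrow> \<phi> p = pcompose p w"
proof -
  note sub = subalgebraD[OF A] and aut = alg_autsD[OF \<phi>]
  have \<phi>_0: "\<phi> 0 = 0"
    using aut(6)[of 0 0] sub(1) by simp
  have \<phi>_power: "\<phi> (p ^ k) = \<phi> p ^ k" if "p \<in> A" for p k
    by (induction k) (simp_all add: that aut subalgebra_power[OF A])
  have \<phi>_sum: "\<phi> (sum g I) = (\<Sum>j\<in>I. \<phi> (g j))"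
    if "finite I" "\<And>j. j \<in> I \<Longrightarrow> g j \<in> A" for I :: "nat set" and g
  proof -
    have "\<phi> (sum g I) = (\<Sum>j\<in>I. \<phi> (g j)) \<and> sum g I \<in> A"
      using that by (induction I rule: finite_induct) (auto simp: \<phi>_0 sub aut)
    then show ?thesis ..
  qed
  have mon: "monom 1 k \<in> A" if "k \<ge> m" for k
    using ideal that by (auto simp: mem_x_power_ideal_iff monom_1_dvd_iff' subset_iff)
  define u v where "u = \<phi> (monom 1 m)" and "v = \<phi> (monom 1 (m + 1))"
  have "u \<noteq> 0"
    using aut(1) mon[of m] sub(1) \<phi>_0 unfolding u_def bij_betw_def
    by (metis inj_on_contraD monom_eq_0_iff order_refl zero_neq_one)
  have "v ^ m = u ^ (m + 1)"
    unfolding u_def v_def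
    by (subst (1 2) \<phi>_power[symmetric])
       (simp_all add: mon monom_power mult.commute del: power_Suc)
  then have "u ^ m dvd v ^ m"
    by simp
  then have "u dvd v"
    using m power_dvd_power_imp_dvd by blast
  then obtain w where v: "v = u * w" ..
  then have "u ^ m * w ^ m = u ^ m * u"
    using \<open>v ^ m = u ^ (m + 1)\<close> by (simp add: power_mult_distrib)
  then have u: "u = w ^ m"
    using \<open>u \<noteq> 0\<close> by simp
  have \<phi>_monom: "\<phi> (monom 1 k) = w ^ k" if k: "k \<ge> m" for k
  proof -
    \<comment> \<open>The product \<open>x ^ k * (x ^ m) ^ k\<close> is a power of
      \<open>x ^ (m + 1)\<close>, whose image is known; the nonzero factor \<open>u ^ k\<close> is
      then cancelled.\<close>
    have "\<phi> (monom 1 k) * u ^ k = \<phi> (monom 1 k * monom 1 m ^ k)"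
      by (simp add: u_def aut \<phi>_power mon subalgebra_power[OF A] k)
    also have "monom 1 k * monom 1 m ^ k = (monom 1 (m + 1) ^ k :: 'a poly)"
      by (simp add: monom_power mult_monom algebra_simps)
    also have "\<phi> \<dots> = w ^ k * u ^ k"
      unfolding \<phi>_power[OF mon[OF le_add1]] v_def[symmetric] v power_mult_distrib
      by (rule mult.commute)
    finally show ?thesis
      using \<open>u \<noteq> 0\<close> by simp
  qed
  have "\<phi> p = pcompose p w" if p: "p \<in> A" for p
  proof -
    \<comment> \<open>The single terms of \<open>p\<close> may lie outside \<open>A\<close>. After
      multiplication by \<open>x ^ m\<close> they all lie in \<open>A\<close>, and linearity of
      \<open>\<phi>\<close> applies.\<close>
    have "p * monom 1 m = (\<Sum>j\<le>degree p. monom (coeff p j) j) * monom 1 m"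
      by (simp add: poly_as_sum_of_monoms)
    also have "\<dots> = (\<Sum>j\<le>degree p. smult (coeff p j) (monom 1 (j + m)))"
      by (simp add: sum_distrib_right mult_monom smult_monom)
    finally have "\<phi> (p * monom 1 m) = (\<Sum>j\<le>degree p. smult (coeff p j) (w ^ (j + m)))"
      by (simp add: \<phi>_sum aut sub mon \<phi>_monom)
    also have "\<dots> = pcompose p w * w ^ m"
      by (simp add: pcompose_eq_sum sum_distrib_right power_add)
    finally have "\<phi> p * u = pcompose p w * u"
      using p by (simp add: aut mon u_def \<phi>_monom)
    then show ?thesis
      using \<open>u \<noteq> 0\<close> by simp
  qed
  then show ?thesis
    by (rule that)
qed

text \<open>Up to a scalar, \<open>q\<close> is \<open>1 - r\<close> with \<open>r\<close> divisible
  by \<open>x\<close>. The geometric series in \<open>r\<close> terminates modulo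
  \<open>x ^ m\<close> and inverts it.\<close>

lemma ex_inverse_mod_monom:
  fixes q :: "'a::field poly"
  assumes "coeff q 0 \<noteq> 0"
  obtains s t where "q * s + monom 1 m * t = 1"
proof -
  define b where "b = coeff q 0"
  define r where "r = 1 - smult (inverse b) q"
  have "monom 1 1 dvd r"
    using assms unfolding monom_1_dvd_iff' by (simp add: r_def b_def)
  then have "monom 1 1 ^ m dvd r ^ m"
    by (rule dvd_power_same)
  then obtain t where t: "r ^ m = monom 1 m * t"
    by (auto simp: monom_power elim: dvdE)
  have "1 - r ^ m = (1 - r) * (\<Sum>k<m. r ^ k)"
    by (rule one_diff_power_eq)
  also have "\<dots> = q * smult (inverse b) (\<Sum>k<m. r ^ k)"
    by (simp add: r_def)
  finally show ?thesis
    using t by (intro that[of "smult (inverse b) (\<Sum>k<m. r ^ k)" t]) (simp add: algebra_simps)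
qed

section \<open>Scalings and the group they form\<close>

lemma coeff_t_aut: "coeff (t_aut z p) k = z ^ k * coeff p k"
  by (simp add: t_aut_def coeff_pcompose_linear)

lemma t_aut_t_aut: "t_aut y (t_aut z p) = t_aut (y * z) p"
  by (simp add: poly_eq_iff coeff_t_aut power_mult_distrib)

lemma t_aut_one [simp]: "t_aut 1 p = p"
  by (simp add: poly_eq_iff coeff_t_aut)

lemma alg_aut_eq_t_aut:
  fixes A :: "'a::alg_closed_field poly set"
  assumes A: "A \<in> algs m" and \<phi>: "\<phi> \<in> alg_auts A"
  obtains a where "a \<noteq> 0" "\<phi> = restrict (t_aut a) A"
proof -
  have sub: "subalgebra A" and ideal: "x_power_ideal m \<subseteq> A" and notin: "monom 1 (m - 1) \<notin> A"
    using A by (auto simp: algs_def)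
  note aut = alg_autsD[OF \<phi>]
  have multiple_A: "monom 1 m * h \<in> A" for h
    using ideal by (auto simp: x_power_ideal_def)
  \<comment> \<open>For \<open>m = 0\<close> truncated subtraction would make the excluded monomial
    equal to 1, which lies in the ideal.\<close>
  have m: "m > 0"
    using multiple_A[of 1] notin by (cases "m = 0") auto
  obtain w where w: "\<And>p. p \<in> A \<Longrightarrow> \<phi> p = pcompose p w"
    using alg_aut_eq_pcompose[OF sub ideal m \<phi>] by blast
  have surj: "\<exists>p\<in>A. pcompose p w = q" if "q \<in> A" for q
    using aut(1) that w unfolding bij_betw_def by (metis image_iff)
  \<comment> \<open>Each such \<open>x ^ k\<close> has a preimage \<open>p\<close>, and degrees
    multiply under composition. Two consecutive exponents then force degree 1.\<close>
  have dvd: "degree w dvd k" if "k \<ge> m" for k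
  proof -
    have "monom 1 k \<in> A"
      using that ideal by (auto simp: mem_x_power_ideal_iff monom_1_dvd_iff' subset_iff)
    then obtain p where "pcompose p w = monom 1 k"
      using surj by blast
    then have "degree p * degree w = k"
      by (metis degree_monom_eq degree_pcompose zero_neq_one)
    then show ?thesis
      by auto
  qed
  have "degree w dvd (m + 1) - m"
    by (intro dvd_diff_nat dvd) auto
  then have "degree w = 1"
    by simp
  obtain b w' where w': "w = pCons b w'"
    by (rule pCons_cases)
  with \<open>degree w = 1\<close> have "degree w' = 0" "w' \<noteq> 0"
    by (auto split: if_splits)
  then obtain a where wba: "w = [:b, a:]" "a \<noteq> 0"
    using w' by (auto elim: degree_eq_zeroE)
  have "b = 0"
  proof (rule ccontr)
    assume "b \<noteq> 0"
    \<comment> \<open>A linear \<open>w\<close> is invertible under composition, so every multiple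
      of \<open>w ^ m\<close> is the image of a multiple of \<open>x ^ m\<close>.\<close>
    have wm: "w ^ m * h \<in> A" for h
    proof -
      have "pcompose [:-b / a, 1 / a:] w = [:0, 1:]"
        using wba by (simp add: pcompose_pCons)
      then have "h = pcompose (pcompose h [:-b / a, 1 / a:]) w"
        by (metis pcompose_assoc pcompose_idR)
      then have "w ^ m * h = pcompose (monom 1 m * pcompose h [:-b / a, 1 / a:]) w"
        by (simp add: pcompose_mult pcompose_monom)
      also have "\<dots> = \<phi> (monom 1 m * pcompose h [:-b / a, 1 / a:])"
        using w multiple_A by simp
      finally show ?thesis
        using aut(1) multiple_A by (simp add: bij_betw_apply)
    qed
    have "coeff (w ^ m) 0 \<noteq> 0"
      using \<open>b \<noteq> 0\<close> wba by (simp add: coeff_0_power)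
    then obtain s t where "w ^ m * s + monom 1 m * t = 1"
      using ex_inverse_mod_monom by blast
    \<comment> \<open>Multiplying the Bezout identity by \<open>x ^ (m - 1)\<close> puts the
      forbidden monomial into \<open>A\<close>.\<close>
    then have "w ^ m * (s * monom 1 (m - 1)) + monom 1 m * (t * monom 1 (m - 1)) = monom 1 (m - 1)"
      by (simp flip: mult.assoc distrib_right)
    then show False
      using notin wm multiple_A subalgebraD(3)[OF sub] by metis
  qed
  have "\<phi> = restrict (t_aut a) A"
    using aut(2) w wba(1) \<open>b = 0\<close> by (auto simp: fun_eq_iff t_aut_def extensional_def)
  then show ?thesis
    using that \<open>a \<noteq> 0\<close> by blast
qed

lemma restrict_t_aut_mem_alg_auts:
  assumes A: "subalgebra A" and "a \<noteq> 0"
    and "\<And>p. p \<in> A \<Longrightarrow> t_aut a p \<in> A" "\<And>p. p \<in> A \<Longrightarrow> t_aut (inverse a) p \<in> A"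
  shows "restrict (t_aut a) A \<in> alg_auts A"
proof -
  have "bij_betw (t_aut a) A A"
    by (rule bij_betw_byWitness[where f' = "t_aut (inverse a)"])
       (use assms in \<open>auto simp: t_aut_t_aut\<close>)
  then show ?thesis
    using subalgebraD[OF A] unfolding alg_auts_def Bij_def
    by (auto simp: t_aut_def pcompose_add pcompose_mult pcompose_smult pcompose_1
          intro: bij_betw_cong[THEN iffD1])
qed

lemma Aut_alg_simps:
  "carrier (Aut_alg A) = alg_auts A"
  "\<one>\<^bsub>Aut_alg A\<^esub> = restrict (\<lambda>p. p) A"
  "\<phi> \<in> alg_auts A \<Longrightarrow> \<psi> \<in> alg_auts A \<Longrightarrow> \<phi> \<otimes>\<^bsub>Aut_alg A\<^esub> \<psi> = compose A \<phi> \<psi>"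
  by (simp_all add: Aut_alg_def BijGroup_def alg_auts_def)

text \<open>Automorphisms are scalings by \<open>d\<close>-th roots of unity, that is, by powers of
  \<open>z\<close>. The exponent \<open>d\<close> is left open to cover both \<open>l_of m i\<close>
  and its part prime to the characteristic.\<close>

lemma carrier_Aut_alg_eq_generate:
  fixes A :: "'a::alg_closed_field poly set"
  assumes A: "A \<in> algs m"
    and stab: "\<And>a::'a. a \<noteq> 0 \<Longrightarrow> (\<forall>p\<in>A. t_aut a p \<in> A) \<longleftrightarrow> a ^ d = 1"
    and z: "is_primitive_root d z"
  shows "carrier (Aut_alg A) = generate (Aut_alg A) {restrict (t_aut z) A}"
proof -
  have sub: "subalgebra A"
    using A by (simp add: algs_def)
  interpret group "Aut_alg A"
    using group_Aut_alg[OF sub] .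
  let ?g = "\<lambda>a. restrict (t_aut a) A"
  have "d > 0" "z ^ d = 1"
    using z by (auto simp: is_primitive_root_def)
  have nz: "a \<noteq> 0" if "a ^ d = 1" for a :: 'a
    using that \<open>d > 0\<close> by (auto simp: zero_power)
  have mem: "?g a \<in> alg_auts A" and mem_A: "\<And>p. p \<in> A \<Longrightarrow> t_aut a p \<in> A" if "a ^ d = 1" for a
  proof -
    have "\<forall>p\<in>A. t_aut a p \<in> A" "\<forall>p\<in>A. t_aut (inverse a) p \<in> A"
      using stab[of a] stab[of "inverse a"] nz[OF that] that by (auto simp: power_inverse)
    then show "?g a \<in> alg_auts A" "\<And>p. p \<in> A \<Longrightarrow> t_aut a p \<in> A"
      using restrict_t_aut_mem_alg_auts[OF sub nz[OF that]] by auto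
  qed
  have powers: "?g (z ^ k) \<in> generate (Aut_alg A) {?g z}" for k
  proof (induction k)
    case 0
    then show ?case
      using generate.one[of "Aut_alg A" "{?g z}"] by (simp only: Aut_alg_simps power_0 t_aut_one)
  next
    case (Suc k)
    have "(z ^ k) ^ d = 1"
      using \<open>z ^ d = 1\<close> by (metis mult.commute power_mult power_one)
    then have "?g z \<otimes>\<^bsub>Aut_alg A\<^esub> ?g (z ^ k) = ?g (z ^ Suc k)"
      using \<open>z ^ d = 1\<close>
      by (auto simp: Aut_alg_simps mem mem_A compose_def t_aut_t_aut fun_eq_iff)
    then show ?case
      using generate.eng[OF generate.incl[OF singletonI] Suc.IH] by (simp only:)
  qed
  show ?thesis
  proof
    show "generate (Aut_alg A) {?g z} \<subseteq> carrier (Aut_alg A)"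
      using mem[OF \<open>z ^ d = 1\<close>] by (intro generate_incl) (auto simp: Aut_alg_simps)
    show "carrier (Aut_alg A) \<subseteq> generate (Aut_alg A) {?g z}"
    proof
      fix \<phi> assume "\<phi> \<in> carrier (Aut_alg A)"
      then have \<phi>: "\<phi> \<in> alg_auts A"
        by (simp add: Aut_alg_simps)
      then obtain a where a: "a \<noteq> 0" "\<phi> = ?g a"
        using alg_aut_eq_t_aut[OF A] by blast
      have "\<phi> p \<in> A" if "p \<in> A" for p
        using alg_autsD(1)[OF \<phi>] that by (rule bij_betw_apply)
      then have "a ^ d = 1"
        using a stab[of a] by auto
      then obtain k where "a = z ^ k"
        using root_of_unity_eq_power[OF z] by blast
      then show "\<phi> \<in> generate (Aut_alg A) {?g z}"
        using a powers by simp
    qed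
  qed
qed
section \<open>The algebra generated by the binomial\<close>

text \<open>The coefficients at positions in \<open>S\<close> are dual coordinates for
  \<open>b\<close>, which gives independence. For spanning, \<open>p\<close> minus the combination
  with its own coefficients vanishes on \<open>S\<close>, hence is 0.\<close>

lemma is_basis_of_dual:
  fixes b :: "nat \<Rightarrow> 'a::field poly"
  assumes "finite S" and V: "poly_vs.subspace V" and bV: "\<And>j. j \<in> S \<Longrightarrow> b j \<in> V"
    and dual: "\<And>j k. j \<in> S \<Longrightarrow> k \<in> S \<Longrightarrow> coeff (b j) k = of_bool (j = k)"
    and zero: "\<And>p. p \<in> V \<Longrightarrow> (\<And>k. k \<in> S \<Longrightarrow> coeff p k = 0) \<Longrightarrow> p = 0"
  shows "is_basis_of (b ` S) V"
proof -
  have coeff_lincomb: "coeff (\<Sum>j\<in>S. smult (u j) (b j)) k = u k" if "k \<in> S" for u k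
    using that \<open>finite S\<close> by (simp add: coeff_sum dual of_bool_def if_distrib cong: if_cong)
  have inj: "inj_on b S"
    by (rule inj_onI) (metis dual of_bool_eq_1_iff)
  have "poly_vs.independent (b ` S)"
    unfolding poly_vs.dependent_finite[OF finite_imageI[OF \<open>finite S\<close>]] sum.reindex[OF inj]
    using coeff_lincomb by (auto simp: o_def) (metis coeff_0)
  moreover have "p \<in> poly_vs.span (b ` S)" if "p \<in> V" for p
  proof -
    let ?q = "\<Sum>j\<in>S. smult (coeff p j) (b j)"
    have "?q \<in> V"
      using V bV by (intro poly_vs.subspace_sum poly_vs.subspace_scale) auto
    then have "p - ?q \<in> V"
      using V that by (intro poly_vs.subspace_diff)
    then have "p = ?q"
      using zero[of "p - ?q"] coeff_lincomb by simp
    moreover have "?q \<in> poly_vs.span (b ` S)"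
      by (intro poly_vs.span_sum poly_vs.span_scale poly_vs.span_base) auto
    ultimately show ?thesis
      by simp
  qed
  moreover have "poly_vs.span (b ` S) \<subseteq> V"
    using V bV by (intro poly_vs.span_minimal) auto
  ultimately show ?thesis
    unfolding is_basis_of_def by blast
qed

locale binomial_params =
  fixes m i :: nat
  assumes i_dvd: "i dvd m - 1" and i_ge_2: "2 \<le> i" and n_ge_2: "2 \<le> n_of m i"
    and n_not_dvd_1: "\<not> n_of m i dvd m - 1" and n_not_dvd_2: "\<not> n_of m i dvd m - 2"
begin

abbreviation "n \<equiv> n_of m i"
abbreviation "l \<equiv> l_of m i"

text \<open>Exact division gives \<open>m - 1 = i * (n + 1)\<close> and
  \<open>l = (i - 1) * (n + 1)\<close>.\<close>

lemma params: "m \<ge> 6" "l > 0" "n + l = m - 2"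
proof -
  have eq: "m - 1 = i * (n + 1)"
    using i_dvd n_ge_2 by (auto simp: n_of_def)
  have "i * (n + 1) \<ge> 2 * 3"
    using i_ge_2 n_ge_2 by (intro mult_mono) auto
  then show "m \<ge> 6"
    using eq by simp
  have l: "l = (i - 1) * (n + 1)"
    unfolding l_of_def eq using i_ge_2
    by (metis div_mult_self1_is_m mult.left_commute not_numeral_le_zero zero_less_iff_neq_zero)
  then show "l > 0"
    using i_ge_2 by simp
  have "n + 1 + l = i * (n + 1)"
    using l i_ge_2 by (cases i) auto
  then show "n + l = m - 2"
    using eq by simp
qed

lemma mult_n_neq: "m - 2 \<noteq> j * n" "j * n \<noteq> m - 2"
  using n_not_dvd_2 dvd_triv_right by metis+

lemma f_of_eq: "f_of m i = monom 1 n + monom 1 (m - 2)"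
  by (simp add: f_of_def distrib_left mult_monom params)

lemma coeff_f_of_power:
  assumes "k < m"
  shows "coeff (f_of m i ^ j :: 'a::field poly) k = of_bool (k = j * n \<or> j = 1 \<and> k = m - 2)"
proof (cases "j \<le> 1")
  case True
  then consider "j = 0" | "j = 1"
    by linarith
  then show ?thesis
    using params n_ge_2 by cases (auto simp: f_of_eq)
next
  case False
  let ?f = "f_of m i :: 'a poly"
  have "monom 1 n dvd ?f"
    by (simp add: f_of_def)
  \<comment> \<open>This product kills the second summand of \<open>f_of m i\<close> in all powers
    from the square on; it uses \<open>n \<ge> 2\<close>.\<close>
  have *: "monom 1 m dvd (monom 1 n * monom 1 (m - 2) :: 'a poly)"
    using n_ge_2 params by (simp add: mult_monom monom_1_dvd_iff')
  \<comment> \<open>The index is shifted by 2 because the congruence fails for the first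
    power.\<close>
  have "monom 1 m dvd ?f ^ (Suc (Suc j)) - monom 1 (Suc (Suc j) * n)" for j
  proof -
    have eq: "?f ^ Suc j - monom 1 (Suc j * n)
        = ?f ^ j * monom 1 (m - 2) + monom 1 n * (?f ^ j - monom 1 (j * n))" for j
      by (simp add: f_of_eq algebra_simps mult_monom)
    have dvd: "monom 1 m dvd ?f ^ Suc j * monom 1 (m - 2)" for j
      using dvd_trans[OF * mult_dvd_mono[OF dvd_mult2[OF \<open>monom 1 n dvd ?f\<close>] dvd_refl]] by simp
    show ?thesis
    proof (induction j)
      case 0
      show ?case
        using dvd[of 0] * by (subst eq) (simp add: f_of_eq)
    next
      case (Suc j)
      show ?case
        using dvd[of "Suc j"] Suc by (subst eq) (rule dvd_add[OF _ dvd_mult])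
    qed
  qed
  from this[of "j - 2"] have "monom 1 m dvd ?f ^ j - monom 1 (j * n)"
    using False by (simp add: numeral_2_eq_2 Suc_diff_Suc)
  then have "coeff (?f ^ j) k = coeff (monom 1 (j * n)) k"
    using assms by (simp add: monom_1_dvd_iff')
  then show ?thesis
    using False by simp
qed

text \<open>Constants plus the span of the positive powers of \<open>f_of m i\<close> are exactly
  the polynomials in \<open>f_of m i\<close>. In this form closure under products follows from
  multiplicativity of composition.\<close>

lemma A_of_eq: "A_of m i = {p. \<exists>g. monom 1 m dvd p - pcompose g (f_of m i :: 'a::field poly)}"
proof -
  let ?f = "f_of m i :: 'a poly"
  let ?S = "poly_vs.span {?f ^ j | j. j \<ge> 1}"
  have span: "\<exists>g'. g = pcompose g' ?f" if "g \<in> ?S" for g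
    using that
  proof (induction rule: poly_vs.span_induct_alt)
    case base
    then show ?case
      by (intro exI[of _ 0]) simp
  next
    case (step c x y)
    then obtain j g' where "x = ?f ^ j" "y = pcompose g' ?f"
      by blast
    then show ?case
      by (intro exI[of _ "monom c j + g'"]) (simp add: pcompose_add pcompose_monom)
  qed
  have pcomp: "\<exists>g'\<in>?S. pcompose g ?f = [:coeff g 0:] + g'" for g
  proof -
    have "pcompose g ?f = smult (coeff g 0) (?f ^ 0) + (\<Sum>j=1..degree g. smult (coeff g j) (?f ^ j))"
      unfolding pcompose_eq_sum atMost_atLeast0 by (subst sum.atLeast_Suc_atMost) auto
    moreover have "(\<Sum>j=1..degree g. smult (coeff g j) (?f ^ j)) \<in> ?S"
      by (intro poly_vs.span_sum poly_vs.span_scale poly_vs.span_base) auto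
    ultimately show ?thesis
      by auto
  qed
  show ?thesis
  proof (intro equalityI subsetI)
    fix p :: "'a poly" assume "p \<in> A_of m i"
    then obtain c g h where p: "p = [:c:] + g + h" "g \<in> ?S" "monom 1 m dvd h"
      unfolding A_of_def mem_x_power_ideal_iff by blast
    then obtain g' where "g = pcompose g' ?f"
      using span by blast
    then have "p - pcompose ([:c:] + g') ?f = h"
      using p by (simp add: pcompose_add)
    then show "p \<in> {p. \<exists>g. monom 1 m dvd p - pcompose g ?f}"
      using p by blast
  next
    fix p :: "'a poly" assume "p \<in> {p. \<exists>g. monom 1 m dvd p - pcompose g ?f}"
    then obtain g where g: "monom 1 m dvd p - pcompose g ?f"
      by blast
    obtain g' where "g' \<in> ?S" "pcompose g ?f = [:coeff g 0:] + g'"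
      using pcomp by blast
    then have "p = [:coeff g 0:] + g' + (p - pcompose g ?f)"
      by simp
    then show "p \<in> A_of m i"
      unfolding A_of_def mem_x_power_ideal_iff using g \<open>g' \<in> ?S\<close> by blast
  qed
qed

lemma mem_A_of_iff:
  fixes p :: "'a::field poly"
  shows "p \<in> A_of m i \<longleftrightarrow>
    coeff p n = coeff p (m - 2) \<and> (\<forall>k<m. \<not> n dvd k \<longrightarrow> k \<noteq> m - 2 \<longrightarrow> coeff p k = 0)"
    (is "_ \<longleftrightarrow> ?P p")
proof
  let ?f = "f_of m i :: 'a poly"
  have lt: "n < m" "m - 2 < m" "m - 2 \<noteq> n"
    using params by auto
  note neq = lt(3) mult_n_neq
  {
    assume "p \<in> A_of m i"
    then obtain g where g: "monom 1 m dvd p - pcompose g ?f"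
      unfolding A_of_eq by blast
    then have coeff: "coeff p k = (\<Sum>j\<le>degree g. coeff g j * coeff (?f ^ j) k)" if "k < m" for k
      using that by (simp add: monom_1_dvd_iff' pcompose_eq_sum coeff_sum)
    \<comment> \<open>The sums agree term by term: since \<open>n\<close> does not divide
      \<open>m - 2\<close>, only the first power of \<open>f_of m i\<close> contributes to either
      coefficient.\<close>
    have "coeff p n = coeff p (m - 2)"
      unfolding coeff[OF lt(1)] coeff[OF lt(2)] using lt neq n_ge_2
      by (intro sum.cong) (auto simp: coeff_f_of_power)
    moreover have "coeff p k = 0" if "k < m" "\<not> n dvd k" "k \<noteq> m - 2" for k
      unfolding coeff[OF that(1)] using that
      by (intro sum.neutral) (auto simp: coeff_f_of_power)
    ultimately show "?P p"
      by blast
  }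
  assume P: "?P p"
  \<comment> \<open>Below \<open>x ^ m\<close> the monomial \<open>x ^ (j * n)\<close> occurs only
    in the \<open>j\<close>-th power, so its coefficient in \<open>p\<close> dictates that of
    \<open>g\<close>. The bound \<open>m\<close> covers every \<open>j\<close> with
    \<open>j * n < m\<close>.\<close>
  define g where "g = (\<Sum>j\<le>m. monom (coeff p (j * n)) j)"
  have "pcompose g ?f = (\<Sum>j\<le>m. smult (coeff p (j * n)) (?f ^ j))"
    by (simp add: g_def pcompose_sum pcompose_monom)
  then have coeff: "coeff (pcompose g ?f) k
      = (\<Sum>j\<le>m. coeff p (j * n) * of_bool (k = j * n \<or> j = 1 \<and> k = m - 2))" if "k < m" for k
    using that by (simp add: coeff_sum coeff_f_of_power)
  have "coeff (pcompose g ?f) k = coeff p k" if k: "k < m" for k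
  proof -
    consider j where "k = j * n" | "k = m - 2" | "\<not> n dvd k" "k \<noteq> m - 2"
      by (metis dvd_def mult.commute)
    then show ?thesis
    proof cases
      case 1
      have "j \<le> j * n"
        using n_ge_2 by simp
      then have "j \<le> m"
        using 1 k by linarith
      have "coeff (pcompose g ?f) k = (\<Sum>j'\<le>m. if j' = j then coeff p k else 0)"
        unfolding coeff[OF k] using 1 neq n_ge_2 by (intro sum.cong) auto
      then show ?thesis
        using \<open>j \<le> m\<close> by simp
    next
      case 2
      \<comment> \<open>Only \<open>j' = 1\<close> contributes, with weight
        \<open>coeff p n\<close>, which equals \<open>coeff p (m - 2)\<close> by assumption.\<close>
      have "coeff (pcompose g ?f) k = (\<Sum>j'\<le>m. if j' = 1 then coeff p k else 0)"
        unfolding coeff[OF k] using 2 neq P by (intro sum.cong) auto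
      then show ?thesis
        using params by simp
    next
      case 3
      then have "coeff (pcompose g ?f) k = 0"
        unfolding coeff[OF k] by (intro sum.neutral) auto
      then show ?thesis
        using P 3 k by simp
    qed
  qed
  then show "p \<in> A_of m i"
    unfolding A_of_eq monom_1_dvd_iff' by (auto intro!: exI[of _ g])
qed

lemma A_of_mem_algs: "(A_of m i :: 'a::field poly set) \<in> algs m"
proof -
  have "p * q \<in> A_of m i" if pq: "p \<in> A_of m i" "q \<in> A_of m i" for p q :: "'a poly"
  proof -
    obtain g h where g: "monom 1 m dvd p - pcompose g (f_of m i)"
      and h: "monom 1 m dvd q - pcompose h (f_of m i)"
      using pq unfolding A_of_eq by blast
    have "p * q - pcompose (g * h) (f_of m i)
        = (p - pcompose g (f_of m i)) * q + pcompose g (f_of m i) * (q - pcompose h (f_of m i))"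
      by (simp add: pcompose_mult algebra_simps)
    then have "monom 1 m dvd p * q - pcompose (g * h) (f_of m i)"
      using g h by simp
    then show ?thesis
      unfolding A_of_eq by blast
  qed
  moreover have "poly_vs.subspace (A_of m i :: 'a poly set)"
    by (rule poly_vs.subspaceI) (auto simp: mem_A_of_iff)
  moreover have "1 \<in> (A_of m i :: 'a poly set)"
    using n_ge_2 params by (auto simp: mem_A_of_iff intro!: Nat.gr0I)
  moreover have "x_power_ideal m \<subseteq> (A_of m i :: 'a poly set)"
    using params by (auto simp: mem_x_power_ideal_iff monom_1_dvd_iff' mem_A_of_iff)
  moreover have "monom 1 (m - 1) \<notin> (A_of m i :: 'a poly set)"
    using params n_not_dvd_1 by (auto simp: mem_A_of_iff intro!: exI[of _ "m - 1"])
  ultimately show ?thesis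
    by (auto simp: algs_def subalgebra_def)
qed

lemma f_of_mem: "f_of m i \<in> (A_of m i :: 'a::field poly set)"
  using params by (auto simp: mem_A_of_iff f_of_eq)

lemma monom_mem: "2 \<le> j \<Longrightarrow> monom 1 (j * n) \<in> (A_of m i :: 'a::field poly set)"
  using n_ge_2 by (auto simp: mem_A_of_iff mult_n_neq)

text \<open>The exponent \<open>m - 2\<close> cannot be lowest in an element of
  \<open>A_of m i\<close>, since its coefficient equals the one at the smaller exponent
  \<open>n\<close>. The multiples of \<open>n\<close> are realised by \<open>f_of m i\<close> and by
  monomials.\<close>

lemma Gam_A_of: "Gam m (A_of m i :: 'a::field poly set) = {k. 1 \<le> k \<and> k < m \<and> n dvd k}"
proof (intro equalityI subsetI)
  fix k assume "k \<in> Gam m (A_of m i :: 'a poly set)"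
  then obtain a :: "'a poly" where k: "1 \<le> k" "k \<le> m - 1"
    and a: "a \<in> A_of m i" "coeff a k = 1" "\<And>j. j < k \<Longrightarrow> coeff a j = 0"
    by (auto simp: Gam_def)
  have "k \<noteq> m - 2"
    using a(1,2) a(3)[of n] params by (auto simp: mem_A_of_iff)
  then have "n dvd k"
    using a(1,2) k params unfolding mem_A_of_iff
    by (metis Suc_pred' less_Suc_eq_le less_le_trans zero_less_numeral zero_neq_one)
  then show "k \<in> {k. 1 \<le> k \<and> k < m \<and> n dvd k}"
    using k params by simp
next
  fix k assume "k \<in> {k. 1 \<le> k \<and> k < m \<and> n dvd k}"
  then obtain j where k: "k = j * n" "1 \<le> k" "k < m"
    by (auto simp: dvd_def mult.commute)
  show "k \<in> Gam m (A_of m i :: 'a poly set)"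
  proof (cases "j = 1")
    case True
    then have "coeff (f_of m i :: 'a poly) k = 1" "\<forall>j'<k. coeff (f_of m i :: 'a poly) j' = 0"
      using k params by (auto simp: f_of_eq)
    then show ?thesis
      using k f_of_mem unfolding Gam_def by auto
  next
    case False
    then have "j \<ge> 2"
      using k by (cases j) auto
    then show ?thesis
      using k monom_mem[of j] unfolding Gam_def by (auto intro!: bexI[of _ "monom 1 (j * n)"])
  qed
qed

text \<open>Scaling multiplies the two linked coefficients by \<open>a ^ n\<close> and
  \<open>a ^ (m - 2)\<close>, whose quotient is \<open>a ^ l\<close>; necessity is tested on
  \<open>f_of m i\<close>.\<close>

lemma t_aut_stable_iff:
  fixes a :: "'a::field"
  assumes "a \<noteq> 0"
  shows "(\<forall>p\<in>A_of m i. t_aut a p \<in> A_of m i) \<longleftrightarrow> a ^ l = 1"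
proof -
  have "a ^ (m - 2) = a ^ n * a ^ l"
    by (simp flip: params(3) power_add)
  then have iff: "a ^ n = a ^ (m - 2) \<longleftrightarrow> a ^ l = 1"
    using assms by simp
  show ?thesis
  proof
    assume "\<forall>p\<in>A_of m i. t_aut a p \<in> A_of m i"
    then have "t_aut a (f_of m i) \<in> A_of m i"
      using f_of_mem by blast
    then show "a ^ l = 1"
      using params iff by (auto simp: mem_A_of_iff coeff_t_aut f_of_eq)
  next
    assume "a ^ l = 1"
    then show "\<forall>p\<in>A_of m i. t_aut a p \<in> A_of m i"
      using iff by (auto simp: mem_A_of_iff coeff_t_aut)
  qed
qed

section \<open>The truncated algebra and its canonical basis\<close>

lemma quot_A_of:
  "quot_alg m (A_of m i :: 'a::field poly set) = {p \<in> A_of m i. \<forall>k\<ge>m. coeff p k = 0}"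
proof (intro equalityI subsetI)
  fix p :: "'a poly" assume "p \<in> quot_alg m (A_of m i)"
  \<comment> \<open>Membership in \<open>A_of m i\<close> depends only on coefficients below
    \<open>x ^ m\<close>, so truncation does not leave it.\<close>
  then show "p \<in> {p \<in> A_of m i. \<forall>k\<ge>m. coeff p k = 0}"
    using params by (auto simp: quot_alg_def mem_A_of_iff coeff_poly_cutoff)
next
  fix p :: "'a poly" assume p: "p \<in> {p \<in> A_of m i. \<forall>k\<ge>m. coeff p k = 0}"
  then have "poly_cutoff m p = p"
    by (auto simp: poly_eq_iff coeff_poly_cutoff)
  then show "p \<in> quot_alg m (A_of m i)"
    unfolding quot_alg_def using p by (metis (mono_tags) image_eqI mem_Collect_eq)
qed

lemma canonical_basis_A_of:
  fixes A :: "'a::field poly set"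
  defines "A \<equiv> A_of m i"
  shows "is_canonical_basis m A
    (poly_cutoff m ` ({1, f_of m i} \<union> {monom 1 (j * n) | j. 2 \<le> j \<and> j * n < m - 1}))"
    (is "is_canonical_basis m A (poly_cutoff m ` ?B)")
proof -
  let ?f = "f_of m i :: 'a poly"
  define b where "b k = (if k = 0 then 1 else if k = n then ?f else monom 1 k)" for k
  define c :: "nat \<Rightarrow> nat \<Rightarrow> 'a" where "c k k' = of_bool (k = n \<and> k' = m - 2)" for k k'
  define S where "S = insert 0 (Gam m A)"
  have S: "S = {k. k < m \<and> n dvd k}"
    using params by (auto simp: S_def A_def Gam_A_of)
  have lt: "n < m - 2" "m - 2 < m"
    using params by auto
  have notin: "m - 2 \<notin> S" "m - 1 \<notin> S"
    using n_not_dvd_1 n_not_dvd_2 by (auto simp: S)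
  have b_mem: "b k \<in> A" if "k \<in> S" for k
    using that n_ge_2 lt f_of_mem notin
    by (auto simp: A_def b_def S mem_A_of_iff intro!: Nat.gr0I)
  have b_cutoff: "poly_cutoff m (b k) = b k" if "k \<in> S" for k
    using that lt by (auto simp: b_def S f_of_eq poly_eq_iff coeff_poly_cutoff)
  have "?B = b ` S"
  proof -
    have "{monom 1 (j * n) | j. 2 \<le> j \<and> j * n < m - 1} = monom (1::'a) ` (S - {0, n})"
    proof (intro equalityI subsetI)
      fix p assume "p \<in> {monom (1::'a) (j * n) | j. 2 \<le> j \<and> j * n < m - 1}"
      then show "p \<in> monom 1 ` (S - {0, n})"
        using n_ge_2 by (auto simp: S)
    next
      fix p assume "p \<in> monom (1::'a) ` (S - {0, n})"
      then obtain k where k: "p = monom 1 k" "k \<in> S" "k \<noteq> 0" "k \<noteq> n"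
        by blast
      then obtain j where j: "k = j * n"
        by (auto simp: S dvd_def mult.commute)
      then have "j \<noteq> 0" "j \<noteq> 1"
        using k by auto
      \<comment> \<open>\<open>S\<close> allows exponents up to \<open>m - 1\<close>, the stated set
        only those below; they agree because \<open>n\<close> does not divide
        \<open>m - 1\<close>.\<close>
      moreover have "k \<noteq> m - 1"
        using k notin by blast
      ultimately show "p \<in> {monom 1 (j * n) | j. 2 \<le> j \<and> j * n < m - 1}"
        using k j by (auto simp: S intro!: exI[of _ j])
    qed
    also have "\<dots> = b ` (S - {0, n})"
      by (intro image_cong) (auto simp: b_def)
    finally have "?B = b ` ({0, n} \<union> (S - {0, n}))"
      using n_ge_2 by (auto simp: b_def image_Un)
    also have "{0, n} \<union> (S - {0, n}) = S"
      using lt by (auto simp: S)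
    finally show ?thesis .
  qed
  then have cutoff_B: "poly_cutoff m ` ?B = b ` S"
    by (simp add: image_image b_cutoff)
  have "b k = monom 1 k + (\<Sum>k'\<in>{k<..m - 1} - Gam m A. monom (c k k') k')"
    if k: "k \<in> Gam m A" for k
  proof (cases "k = n")
    case True
    have "(\<Sum>k'\<in>{k<..m - 1} - Gam m A. monom (c k k') k')
        = (\<Sum>k'\<in>{k<..m - 1} - Gam m A. if k' = m - 2 then monom 1 (m - 2) else 0)"
      using True by (intro sum.cong) (auto simp: c_def)
    also have "\<dots> = monom 1 (m - 2)"
      using True lt notin by (auto simp: S_def)
    finally show ?thesis
      using True n_ge_2 by (auto simp: b_def f_of_eq)
  next
    case False
    moreover have "k \<noteq> 0"
      using k by (auto simp: Gam_def)
    ultimately show ?thesis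
      by (simp add: b_def c_def)
  qed
  moreover have "is_basis_of (b ` S) (quot_alg m A)"
  proof (rule is_basis_of_dual)
    show "finite S"
      by (simp add: S)
    show "poly_vs.subspace (quot_alg m A)"
      unfolding A_def quot_A_of
      by (rule poly_vs.subspaceI) (auto simp: mem_A_of_iff)
    show "b k \<in> quot_alg m A" if "k \<in> S" for k
      using that b_mem b_cutoff unfolding quot_alg_def by (metis image_eqI)
    \<comment> \<open>The extra term of \<open>f_of m i\<close> sits at \<open>m - 2\<close>,
      outside \<open>S\<close>, so duality holds on \<open>S\<close>.\<close>
    show "coeff (b j) k = of_bool (j = k)" if "j \<in> S" "k \<in> S" for j k
      using that lt notin by (auto simp: b_def f_of_eq)
    \<comment> \<open>The coefficient at \<open>m - 2\<close> equals the one at \<open>n\<close>,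
      which is in \<open>S\<close>; the others outside \<open>S\<close> vanish by membership in
      \<open>A\<close> or by truncation.\<close>
    show "p = 0" if p: "p \<in> quot_alg m A" and zero: "\<And>k. k \<in> S \<Longrightarrow> coeff p k = 0" for p
    proof (rule poly_eqI)
      fix k
      show "coeff p k = coeff 0 k"
        using p zero[of k] zero[of n] lt unfolding A_def quot_A_of mem_A_of_iff
        by (cases "k < m"; cases "n dvd k"; cases "k = m - 2") (auto simp: S)
    qed
  qed
  moreover have "b ` S = insert 1 (b ` Gam m A)"
    by (simp add: S_def b_def[of 0])
  ultimately show ?thesis
    unfolding is_canonical_basis_def cutoff_B by blast
qed

end

theorem lemma3p13:
  fixes m i :: nat
    and f :: "'a::alg_closed_field poly" and A :: "'a poly set"
  assumes "m \<ge> 4"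
    and "i dvd m - 1"
    and "2 \<le> i" and "real i \<le> (real m - 1) / 2"
    and "n_of m i \<ge> 2"
    and "\<not> n_of m i dvd m - 1" and "\<not> n_of m i dvd m - 2"
    and "f = f_of m i" and "A = A_of m i"
  shows
    "(A \<in> algs m \<and>
      Gam m A = {j * n_of m i | j. 1 \<le> j \<and> real j < (real m - 1) / real (n_of m i)} \<and>
      is_canonical_basis m A
        (poly_cutoff m ` ({1, f} \<union>
           {monom 1 (j * n_of m i) | j. 2 \<le> j \<and> real j < (real m - 1) / real (n_of m i)})) \<and>
      f = monom 1 (n_of m i) + monom 1 (m - 2)) \<and>
     (CHAR('a) = 0 \<longrightarrow>
        (\<exists>z::'a. is_primitive_root (l_of m i) z) \<and>
        (\<forall>z::'a. is_primitive_root (l_of m i) z \<longrightarrow>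
           carrier (Aut_alg A) = generate (Aut_alg A) {restrict (t_aut z) A})) \<and>
     (\<forall>p. CHAR('a) = p \<and> p > 0 \<longrightarrow>
        (\<exists>z::'a. is_primitive_root (coprime_part p (l_of m i)) z) \<and>
        (\<forall>z::'a. is_primitive_root (coprime_part p (l_of m i)) z \<longrightarrow>
           carrier (Aut_alg A) = generate (Aut_alg A) {restrict (t_aut z) A}))"
proof -
  interpret binomial_params m i
    by unfold_locales (use assms in auto)
  note [simp] = \<open>f = f_of m i\<close> \<open>A = A_of m i\<close>
  have less_iff: "real j < (real m - 1) / real n \<longleftrightarrow> j * n < m - 1" for j
  proof -
    have "real j < (real m - 1) / real n \<longleftrightarrow> real (j * n) < real (m - 1)"
      using n_ge_2 params(1) by (simp add: pos_less_divide_eq of_nat_diff)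
    then show ?thesis
      by (simp only: of_nat_less_iff)
  qed
  have "Gam m A = {j * n | j. 1 \<le> j \<and> j * n < m - 1}"
  proof (intro equalityI subsetI)
    fix k assume "k \<in> Gam m A"
    then have k: "1 \<le> k" "k < m" "n dvd k"
      by (auto simp: Gam_A_of)
    then obtain j where "k = j * n"
      by (auto simp: dvd_def mult.commute)
    moreover have "k \<noteq> m - 1"
      using n_not_dvd_1 k by blast
    ultimately show "k \<in> {j * n | j. 1 \<le> j \<and> j * n < m - 1}"
      using k by (auto intro!: exI[of _ j] Nat.gr0I simp: Suc_le_eq)
  next
    fix k assume "k \<in> {j * n | j. 1 \<le> j \<and> j * n < m - 1}"
    then show "k \<in> Gam m A"
      using n_ge_2 by (auto simp: Gam_A_of Suc_le_eq)
  qed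
  then have part1: "A \<in> algs m \<and>
      Gam m A = {j * n | j. 1 \<le> j \<and> real j < (real m - 1) / real n} \<and>
      is_canonical_basis m A (poly_cutoff m ` ({1, f} \<union>
           {monom 1 (j * n) | j. 2 \<le> j \<and> real j < (real m - 1) / real n})) \<and>
      f = monom 1 n + monom 1 (m - 2)"
    unfolding less_iff using A_of_mem_algs canonical_basis_A_of f_of_eq by simp
  have gen: "carrier (Aut_alg A) = generate (Aut_alg A) {restrict (t_aut z) A}"
    if "is_primitive_root d z" "\<And>a::'a. a ^ l = 1 \<longleftrightarrow> a ^ d = 1" for d and z :: 'a
    unfolding \<open>A = A_of m i\<close>
  proof (rule carrier_Aut_alg_eq_generate[OF A_of_mem_algs _ that(1)])
    fix a :: 'a assume "a \<noteq> 0"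
    then show "(\<forall>p\<in>A_of m i. t_aut a p \<in> A_of m i) \<longleftrightarrow> a ^ d = 1"
      using t_aut_stable_iff[of a] that(2)[of a] by simp
  qed
  have char0: "\<exists>z::'a. is_primitive_root l z" if "CHAR('a) = 0"
    using that params(2) by (intro ex_primitive_root) (simp add: of_nat_eq_0_iff_char_dvd)
  have charp: "(\<exists>z::'a. is_primitive_root (coprime_part p l) z) \<and>
      (\<forall>a::'a. a ^ l = 1 \<longleftrightarrow> a ^ coprime_part p l = 1)"
    if p: "CHAR('a) = p" "p > 0" for p
  proof -
    have prime: "prime CHAR('a)"
      using p by (intro prime_CHAR_semidom) simp
    let ?d = "coprime_part p l"
    have d: "?d = l div p ^ multiplicity p l"
      using coprime_part_eq prime p params(2) by simp
    then have l: "l = ?d * p ^ multiplicity p l"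
      by (simp add: multiplicity_dvd)
    have "\<not> p dvd ?d"
      unfolding d using prime p params(2) multiplicity_decompose[of l p] prime_gt_1_nat[of p] by simp
    then have "of_nat ?d \<noteq> (0::'a)"
      using p by (simp add: of_nat_eq_0_iff_char_dvd)
    \<comment> \<open>Here \<open>a ^ l\<close> is a \<open>p\<close>-power power of
      \<open>a ^ ?d\<close>, and 1 is its own only root of such an exponent in characteristic
      \<open>p\<close>.\<close>
    moreover have "a ^ l = 1 \<longleftrightarrow> a ^ ?d = 1" for a :: 'a
      using power_CHAR_power_eq_1_iff[OF prime, of "a ^ ?d" "multiplicity p l"] p
      by (subst l) (simp add: power_mult)
    ultimately show ?thesis
      using ex_primitive_root by blast
  qed
  show ?thesis
    using part1 gen[OF _ refl] char0 gen charp by blast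
qed

end
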